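(* Let $h_{S,T}\in\mathcal H$ with $S\cup T=\{k,k+1,\dots,k+2n-1\}$. Then $$h_{S,T}\in\langle h_k,h_{k+1},\dots,h_{k+2n-2},h_{S-\{k\},\,T-\{k+2n-1\}}\rangle,$$ a $2n$-fold Massey product in $HX$.
   Context: $X=\mathbb F_2[R_{ij}:0\le i<j]$ is the commutative polynomial algebra with derivation $dR_{ij}=\sum_{k=i+1}^{j-1}R_{ik}R_{kj}$ ($d^2=0$); $R_{ij}=0$ if $i\ge j$; $HX$ is its homology algebra; $h_i=[R_{i,i+1}]$. For finite sets $S=\{s_1<\dots<s_n\}$, $T=\{t_1<\dots<t_n\}$ of nonnegative integers, $R_{S,T}=\det(R_{s_it_j})$ ($R_{\emptyset,\emptyset}=1$). If $S\cup T$ consists of $2n$ consecutive integers, $R_{S,T}$ is a cycle and $h_{S,T}=[R_{S,T}]$. $\mathcal H$ is the set of all such $h_{S,T}$ ($n\ge1$) with $s_j<t_j$ for $1\le j\le n$ and $s_j<t_{j-1}$ for $2\le j\le n$ (so $\min S=k$ and $\max T=k+2n-1$ when $S\cup T=\{k,\dots,k+2n-1\}$). Massey products: for $a_1,\dots,a_m\in HX$, a defining system is a family $a_{ij}\in X$ ($0\le i<j\le m$, $(i,j)\neq(0,m)$) with $a_{i-1,i}$ a cycle representing $a_i$ and $da_{ij}=\sum_{i<l<j}a_{il}a_{lj}$; the Massey product $\langle a_1,\dots,a_m\rangle\subset HX$ is the set of homology classes of $\sum_{0<l<m}a_{0l}a_{lm}$ over all defining systems (defined if a defining system exists). *)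

theory Defs
  imports
    "HOL-Library.Poly_Mapping"
    "HOL-Library.Z2"
    "HOL-Algebra.QuotRing"
    "Jordan_Normal_Form.Determinant"
begin

section \<open>The differential algebra \<open>X\<close>\<close>

typedef index = "{(i, j). i < j} :: (nat \<times> nat) set"
  by (rule exI[of _ "(0, 1)"]) simp

text \<open>
  Monomials are finitely supported exponent functions, and \<open>X\<close> is the monoid algebra over the
  two-element field \<open>bit\<close> of the monoid of monomials.
\<close>

type_synonym monomial = "index \<Rightarrow>\<^sub>0 nat"
type_synonym X = "monomial \<Rightarrow>\<^sub>0 bit"

definition Var :: "index \<Rightarrow> X" where
  "Var v = Poly_Mapping.single (Poly_Mapping.single v 1) 1"

definition R :: "nat \<Rightarrow> nat \<Rightarrow> X" where
  "R i j = (if i < j then Var (Abs_index (i, j)) else 0)"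

definition d_gen :: "index \<Rightarrow> X" where
  "d_gen v = (case Rep_index v of (i, j) \<Rightarrow> \<Sum>k\<in>{i<..<j}. R i k * R k j)"

text \<open>
  The derivation with prescribed values on the generators, by the formula
  \<open>d f = \<Sum>\<^sub>v (\<partial>f/\<partial>v) * d_gen v\<close>; see \<open>derivation_d\<close>, \<open>d_R\<close> and \<open>derivation_unique\<close> below.
\<close>

definition d_monomial :: "monomial \<Rightarrow> X" where
  "d_monomial m = (\<Sum>v\<in>Poly_Mapping.keys m.
     of_nat (Poly_Mapping.lookup m v) *
     Poly_Mapping.single (m - Poly_Mapping.single v 1) 1 * d_gen v)"

definition d :: "X \<Rightarrow> X" where
  "d f = (\<Sum>m\<in>Poly_Mapping.keys f.
     Poly_Mapping.single 0 (Poly_Mapping.lookup f m) * d_monomial m)"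

definition derivation :: "(X \<Rightarrow> X) \<Rightarrow> bool" where
  "derivation D \<longleftrightarrow> (\<forall>f g. D (f + g) = D f + D g) \<and> (\<forall>f g. D (f * g) = D f * g + f * D g)"

lemma X_char_2: "(f::X) + f = 0"
  by (rule poly_mapping_eqI) (subst lookup_add, simp)

lemma X_uminus: "- f = (f::X)"
  using X_char_2[of f] by (simp add: eq_neg_iff_add_eq_0 flip: neg_eq_iff_add_eq_0)

lemma d_monomial_superset:
  assumes "finite A" "Poly_Mapping.keys m \<subseteq> A"
  shows "d_monomial m = (\<Sum>v\<in>A. of_nat (Poly_Mapping.lookup m v) *
     Poly_Mapping.single (m - Poly_Mapping.single v 1) 1 * d_gen v)"
  unfolding d_monomial_def
  by (rule sum.mono_neutral_left) (use assms in \<open>auto simp: in_keys_iff\<close>)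

lemma d_superset:
  assumes "finite A" "Poly_Mapping.keys f \<subseteq> A"
  shows "d f = (\<Sum>m\<in>A. Poly_Mapping.single 0 (Poly_Mapping.lookup f m) * d_monomial m)"
  unfolding d_def
  by (rule sum.mono_neutral_left) (use assms in \<open>auto simp: in_keys_iff\<close>)

lemma d_add: "d (f + g) = d f + d g"
proof -
  let ?A = "Poly_Mapping.keys f \<union> Poly_Mapping.keys g"
  have sub: "Poly_Mapping.keys (f + g) \<subseteq> ?A" by (rule Poly_Mapping.keys_add)
  show ?thesis
    by (simp only: d_superset[of ?A f] d_superset[of ?A g] d_superset[OF _ sub] lookup_add
        single_add distrib_right sum.distrib finite_Un finite_keys Un_upper1 Un_upper2 simp_thms)
qed

lemma d_zero [simp]: "d 0 = 0"
  by (simp add: d_def)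

lemma d_sum: "d (\<Sum>a\<in>A. f a) = (\<Sum>a\<in>A. d (f a))"
  by (induction A rule: infinite_finite_induct) (simp_all add: d_add)

lemma d_single: "d (Poly_Mapping.single m c) = Poly_Mapping.single 0 c * d_monomial m"
  by (subst d_superset[of "{m}"]) auto

lemma monomial_diff_add:
  fixes m m' :: monomial
  assumes "Poly_Mapping.lookup m v \<noteq> 0"
  shows "m + m' - Poly_Mapping.single v 1 = (m - Poly_Mapping.single v 1) + m'"
  using assms by (intro poly_mapping_eqI) (auto simp: lookup_add lookup_minus lookup_single when_def)

lemma d_monomial_add:
  "d_monomial (m + m') =
     d_monomial m * Poly_Mapping.single m' 1 + Poly_Mapping.single m 1 * d_monomial m'"
proof -
  let ?A = "Poly_Mapping.keys m \<union> Poly_Mapping.keys m'"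
  have sub: "Poly_Mapping.keys (m + m') \<subseteq> ?A" by (rule Poly_Mapping.keys_add)
  have 1: "of_nat (Poly_Mapping.lookup m v) *
      Poly_Mapping.single (m + m' - Poly_Mapping.single v 1) (1::bit) =
      of_nat (Poly_Mapping.lookup m v) *
      Poly_Mapping.single (m - Poly_Mapping.single v 1) 1 * Poly_Mapping.single m' 1"
    for v and m m' :: monomial
    using monomial_diff_add[of m v m']
    by (cases "Poly_Mapping.lookup m v = 0") (simp_all add: mult_single mult.assoc)
  have 2: "of_nat (Poly_Mapping.lookup (m + m') v) *
        Poly_Mapping.single (m + m' - Poly_Mapping.single v 1) (1::bit) * d_gen v =
      of_nat (Poly_Mapping.lookup m v) *
        Poly_Mapping.single (m - Poly_Mapping.single v 1) 1 * d_gen v *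
        Poly_Mapping.single m' 1 +
      Poly_Mapping.single m 1 * (of_nat (Poly_Mapping.lookup m' v) *
        Poly_Mapping.single (m' - Poly_Mapping.single v 1) 1 * d_gen v)" for v
    by (simp only: lookup_add of_nat_add distrib_right 1[of m v m']
        1[of m' v m, unfolded add.commute[of m' m]] distrib_left mult_ac)
  show ?thesis
    by (simp only: d_monomial_superset[of ?A m] d_monomial_superset[of ?A m']
        d_monomial_superset[OF _ sub] finite_Un finite_keys Un_upper1 Un_upper2 simp_thms 2
        sum.distrib sum_distrib_left sum_distrib_right)
qed

lemma X_eq_sum: "(f::X) = (\<Sum>m\<in>Poly_Mapping.keys f. Poly_Mapping.single m (Poly_Mapping.lookup f m))"
  by (intro poly_mapping_eqI)
     (auto simp: lookup_sum lookup_single when_def in_keys_iff)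

lemma d_mult_single:
  "d (Poly_Mapping.single m a * Poly_Mapping.single m' b) =
     d (Poly_Mapping.single m a) * Poly_Mapping.single m' b +
     Poly_Mapping.single m a * d (Poly_Mapping.single m' b)"
proof -
  have s: "Poly_Mapping.single m a = Poly_Mapping.single 0 a * Poly_Mapping.single m (1::bit)"
    for m :: monomial and a by (simp add: mult_single)
  have p: "Poly_Mapping.single (0::monomial) (a * b) =
      Poly_Mapping.single 0 a * Poly_Mapping.single 0 b" by (simp add: mult_single)
  show ?thesis
    by (simp only: mult_single d_single d_monomial_add p s[of m a] s[of m' b]) (simp add: algebra_simps)
qed

lemma d_mult: "d (f * g) = d f * g + f * d g"
proof -
  let ?f = "\<lambda>m. Poly_Mapping.single m (Poly_Mapping.lookup f m)"
  let ?g = "\<lambda>m. Poly_Mapping.single m (Poly_Mapping.lookup g m)"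
  let ?F = "Poly_Mapping.keys f" and ?G = "Poly_Mapping.keys g"
  have "d ((\<Sum>m\<in>?F. ?f m) * (\<Sum>m\<in>?G. ?g m)) =
      d (\<Sum>m\<in>?F. ?f m) * (\<Sum>m\<in>?G. ?g m) + (\<Sum>m\<in>?F. ?f m) * d (\<Sum>m\<in>?G. ?g m)"
    by (simp only: d_sum sum_product d_mult_single sum.distrib)
  then show ?thesis by (simp only: X_eq_sum[symmetric])
qed

lemma derivation_d: "derivation d"
  by (simp add: derivation_def d_add d_mult)

lemma d_Var: "d (Var v) = d_gen v"
  by (simp add: Var_def d_single d_monomial_def)

lemma d_R: "d (R i j) = (\<Sum>k\<in>{i<..<j}. R i k * R k j)"
  by (auto simp: R_def d_Var d_gen_def Abs_index_inverse intro!: sum.cong)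

lemma derivation_one: "derivation D \<Longrightarrow> D 1 = 0"
  unfolding derivation_def by (metis add_cancel_right_right mult_1 mult_1_right)

lemma d_one [simp]: "d 1 = 0"
  by (rule derivation_one[OF derivation_d])

lemma derivation_unique:
  assumes D: "derivation D" and R: "\<And>i j. i < j \<Longrightarrow> D (R i j) = (\<Sum>k\<in>{i<..<j}. R i k * R k j)"
  shows "D = d"
proof
  fix f
  have DV: "D (Var v) = d (Var v)" for v
  proof -
    obtain i j where v: "v = Abs_index (i, j)" "i < j"
      by (cases v) auto
    then have "Var v = R i j" by (simp add: R_def)
    then show ?thesis using R[OF v(2)] by (simp add: d_R)
  qed
  have D0: "D 0 = 0" and Dadd: "D (f + g) = D f + D g"
    and Dmult: "D (f * g) = D f * g + f * D g" for f g
    using D unfolding derivation_def by (metis add_cancel_right_right, blast+)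
  have Dsum: "D (\<Sum>a\<in>A. F a) = (\<Sum>a\<in>A. D (F a))" for A :: "monomial set" and F
    by (induction A rule: infinite_finite_induct) (simp_all add: Dadd D0)
  have D1: "D (Poly_Mapping.single m 1) = d (Poly_Mapping.single m 1)" for m
  proof (induction "\<Sum>v\<in>Poly_Mapping.keys m. Poly_Mapping.lookup m v" arbitrary: m)
    case 0
    then have "m = 0" by (intro poly_mapping_eqI) (auto simp: in_keys_iff)
    then show ?case using derivation_one[OF D] by simp
  next
    case (Suc n)
    then obtain v where v: "v \<in> Poly_Mapping.keys m"
      by (metis all_not_in_conv sum.empty nat.distinct(1))
    define m' where "m' = m - Poly_Mapping.single v 1"
    have m: "m = Poly_Mapping.single v 1 + m'"
      using v by (intro poly_mapping_eqI)
        (auto simp: m'_def lookup_add lookup_minus lookup_single when_def in_keys_iff)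
    have "(\<Sum>v\<in>Poly_Mapping.keys m'. Poly_Mapping.lookup m' v) =
        (\<Sum>v\<in>Poly_Mapping.keys m. Poly_Mapping.lookup m' v)"
      by (rule sum.mono_neutral_left)
         (auto simp: m'_def lookup_minus lookup_single when_def in_keys_iff split: if_splits)
    moreover have "(\<Sum>v\<in>Poly_Mapping.keys m. Poly_Mapping.lookup m v) =
        Suc (\<Sum>v\<in>Poly_Mapping.keys m. Poly_Mapping.lookup m' v)"
    proof -
      have "(\<Sum>u\<in>Poly_Mapping.keys m. Poly_Mapping.lookup m u) =
        (\<Sum>u\<in>Poly_Mapping.keys m. (if u = v then 1 else 0) + Poly_Mapping.lookup m' u)"
        by (rule sum.cong) (simp_all add: arg_cong[OF m, of "\<lambda>m. Poly_Mapping.lookup m _"]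
            lookup_add lookup_single when_def)
      also have "\<dots> = Suc (\<Sum>v\<in>Poly_Mapping.keys m. Poly_Mapping.lookup m' v)"
        using v by (simp add: sum.distrib)
      finally show ?thesis .
    qed
    ultimately have "n = (\<Sum>v\<in>Poly_Mapping.keys m'. Poly_Mapping.lookup m' v)"
      using Suc.hyps(2) by simp
    from Suc.hyps(1)[OF this] have IH: "D (Poly_Mapping.single m' 1) = d (Poly_Mapping.single m' 1)" .
    have "Poly_Mapping.single m 1 = Var v * Poly_Mapping.single m' 1"
      by (subst m) (simp add: Var_def mult_single)
    then show ?case by (simp only: Dmult d_mult IH DV)
  qed
  have "D (Poly_Mapping.single m c) = d (Poly_Mapping.single m c)" for m c
    by (cases c) (simp_all add: D1 D0)
  then have "D (\<Sum>m\<in>Poly_Mapping.keys f. Poly_Mapping.single m (Poly_Mapping.lookup f m)) =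
      d (\<Sum>m\<in>Poly_Mapping.keys f. Poly_Mapping.single m (Poly_Mapping.lookup f m))"
    by (simp only: Dsum d_sum)
  then show "D f = d f" by (simp only: X_eq_sum[symmetric])
qed

lemma d_d_R: "d (d (R i j)) = 0"
proof -
  define F where "F k l = (if k < l then R i k * R k l * R l j else 0)" for k l
  have ext: "(\<Sum>l\<in>{i<..<k}. R i l * R l k) * R k j = (\<Sum>l\<in>{i<..<j}. F l k)"
    if "k \<in> {i<..<j}" for k
  proof -
    have "(\<Sum>l\<in>{i<..<k}. R i l * R l k) * R k j = (\<Sum>l\<in>{i<..<k}. F l k)"
      by (simp add: sum_distrib_right F_def)
    also have "\<dots> = (\<Sum>l\<in>{i<..<j}. F l k)"
      by (rule sum.mono_neutral_left) (use that in \<open>auto simp: F_def\<close>)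
    finally show ?thesis .
  qed
  have ext': "R i k * (\<Sum>l\<in>{k<..<j}. R k l * R l j) = (\<Sum>l\<in>{i<..<j}. F k l)"
    if "k \<in> {i<..<j}" for k
  proof -
    have "R i k * (\<Sum>l\<in>{k<..<j}. R k l * R l j) = (\<Sum>l\<in>{k<..<j}. F k l)"
      by (simp add: sum_distrib_left F_def mult.assoc)
    also have "\<dots> = (\<Sum>l\<in>{i<..<j}. F k l)"
      by (rule sum.mono_neutral_left) (use that in \<open>auto simp: F_def\<close>)
    finally show ?thesis .
  qed
  have "d (d (R i j)) = (\<Sum>k\<in>{i<..<j}. (\<Sum>l\<in>{i<..<j}. F l k) + (\<Sum>l\<in>{i<..<j}. F k l))"
    unfolding d_R[of i j] d_sum d_mult d_R[of i] d_R[of _ j]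
    by (rule sum.cong) (simp_all add: ext ext')
  also have "\<dots> = (\<Sum>k\<in>{i<..<j}. \<Sum>l\<in>{i<..<j}. F k l) + (\<Sum>k\<in>{i<..<j}. \<Sum>l\<in>{i<..<j}. F k l)"
    by (subst (2) sum.swap) (simp add: sum.distrib)
  finally show ?thesis by (simp only: X_char_2)
qed

lemma d_d: "d (d f) = 0"
proof -
  define D where "D f = d f + d (d f)" for f
  have "derivation D"
  proof -
    have "D (f * g) = D f * g + f * D g + (d f * d g + d f * d g)" for f g
      by (simp only: D_def d_add d_mult distrib_left distrib_right add_ac)
    then have "D (f * g) = D f * g + f * D g" for f g
      by (simp only: X_char_2 add_0_right)
    moreover have "D (f + g) = D f + D g" for f g
      by (simp only: D_def d_add add_ac)
    ultimately show ?thesis by (simp add: derivation_def)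
  qed
  moreover have "D (R i j) = (\<Sum>k\<in>{i<..<j}. R i k * R k j)" for i j
    by (simp only: D_def d_d_R add_0_right) (rule d_R)
  ultimately have "D = d" by (intro derivation_unique)
  then have "d f + d (d f) = d f" unfolding D_def by metis
  then show ?thesis by simp
qed


section \<open>The homology algebra\<close>

definition cycles :: "X set" where
  "cycles = {x. d x = 0}"

definition boundaries :: "X set" where
  "boundaries = {d y | y. True}"

definition Z_ring :: "X ring" where
  "Z_ring = \<lparr>carrier = cycles, monoid.mult = (*), one = 1, zero = 0, add = (+)\<rparr>"

definition HX :: "X set ring" where
  "HX = Z_ring Quot boundaries"

definition hclass :: "X \<Rightarrow> X set" where
  "hclass x = boundaries +>\<^bsub>Z_ring\<^esub> x"

lemma cring_Z: "cring Z_ring"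
proof (rule cringI)
  show "abelian_group Z_ring"
  proof (rule abelian_groupI)
    fix x assume "x \<in> carrier Z_ring"
    then show "\<exists>y\<in>carrier Z_ring. y \<oplus>\<^bsub>Z_ring\<^esub> x = \<zero>\<^bsub>Z_ring\<^esub>"
      by (intro bexI[of _ x]) (simp_all add: Z_ring_def X_char_2)
  qed (auto simp: Z_ring_def cycles_def d_add add_ac)
  show "comm_monoid Z_ring"
    by (rule comm_monoidI) (auto simp: Z_ring_def cycles_def d_mult mult_ac)
qed (auto simp: Z_ring_def distrib_right)

lemma ideal_boundaries: "ideal boundaries Z_ring"
proof (rule idealI)
  interpret cring Z_ring by (rule cring_Z)
  show "ring Z_ring" by (rule ring_axioms)
  show "subgroup boundaries (add_monoid Z_ring)"
  proof (rule group.subgroupI)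
    show "group (add_monoid Z_ring)" by (rule add.group_axioms)
    show "boundaries \<subseteq> carrier (add_monoid Z_ring)"
      by (auto simp: boundaries_def Z_ring_def cycles_def d_d)
    show "boundaries \<noteq> {}" by (auto simp: boundaries_def)
    fix a assume a: "a \<in> boundaries"
    then have "a \<in> carrier Z_ring" by (auto simp: boundaries_def Z_ring_def cycles_def d_d)
    then have "\<ominus>\<^bsub>Z_ring\<^esub> a = a"
      by (intro minus_equality) (auto simp: Z_ring_def X_char_2)
    then show "inv\<^bsub>add_monoid Z_ring\<^esub> a \<in> boundaries" using a by (simp add: a_inv_def)
    fix b assume "b \<in> boundaries"
    with a show "a \<otimes>\<^bsub>add_monoid Z_ring\<^esub> b \<in> boundaries"
      by (auto simp: boundaries_def Z_ring_def simp flip: d_add)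
  qed
next
  fix a x assume "a \<in> boundaries" "x \<in> carrier Z_ring"
  then obtain y where "a = d y" "d x = 0" by (auto simp: boundaries_def Z_ring_def cycles_def)
  then have "x * a = d (x * y)" "a * x = d (y * x)" by (simp_all add: d_mult)
  then show "x \<otimes>\<^bsub>Z_ring\<^esub> a \<in> boundaries" "a \<otimes>\<^bsub>Z_ring\<^esub> x \<in> boundaries"
    unfolding boundaries_def Z_ring_def by auto
qed

lemma cring_HX: "cring HX"
  unfolding HX_def by (rule ideal.quotient_is_cring[OF ideal_boundaries cring_Z])

lemma carrier_HX: "carrier HX = hclass ` cycles"
  by (auto simp: HX_def FactRing_def A_RCOSETS_def' hclass_def Z_ring_def)

lemma hclass_eq: "hclass x = {d y + x | y. True}"
  by (auto simp: hclass_def a_r_coset_def' boundaries_def Z_ring_def)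

definition h :: "nat \<Rightarrow> X set" where
  "h i = hclass (R i (i + 1))"


section \<open>The classes \<open>h\<^sub>S\<^sub>,\<^sub>T\<close>\<close>

text \<open>
  \<open>elt A j\<close> is the \<open>j\<close>-th smallest element of \<open>A\<close>, where \<open>j\<close> counts from 1.
\<close>

definition elt :: "nat set \<Rightarrow> nat \<Rightarrow> nat" where
  "elt A j = sorted_list_of_set A ! (j - 1)"

text \<open>Matrices are indexed from 0. The determinant of a 0 by 0 matrix is 1.\<close>

definition R_det :: "nat set \<Rightarrow> nat set \<Rightarrow> X" where
  "R_det S T = det (mat (card S) (card T) (\<lambda>(i, j). R (elt S (i + 1)) (elt T (j + 1))))"

definition h_det :: "nat set \<Rightarrow> nat set \<Rightarrow> X set" where
  "h_det S T = hclass (R_det S T)"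

lemma R_det_empty: "R_det {} {} = 1"
  by (simp add: R_det_def)

text \<open>
  The set \<open>\<H>\<close> of classes is represented by its index set: \<open>H_pair S T\<close> says that \<open>h_det S T\<close>
  belongs to \<open>\<H>\<close> by virtue of the pair \<open>(S, T)\<close>. Since the union has \<open>2 * n\<close> elements, \<open>S\<close> and \<open>T\<close>
  are disjoint.
\<close>

definition H_pair :: "nat set \<Rightarrow> nat set \<Rightarrow> bool" where
  "H_pair S T \<longleftrightarrow> (\<exists>n k. n \<ge> 1 \<and> finite S \<and> finite T \<and> card S = n \<and> card T = n \<and>
     S \<union> T = {k..<k + 2 * n} \<and>
     (\<forall>j\<in>{1..n}. elt S j < elt T j) \<and>
     (\<forall>j\<in>{2..n}. elt S j < elt T (j - 1)))"


section \<open>Massey products\<close>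

text \<open>
  The list \<open>as\<close> is \<open>a\<^sub>1, \<dots>, a\<^sub>m\<close>, so that \<open>a\<^sub>i\<close> is \<open>as ! (i - 1)\<close>. Only the values \<open>a i j\<close> with
  \<open>i < j \<le> m\<close> and \<open>(i, j) \<noteq> (0, m)\<close> of the family are relevant.
\<close>

definition defining_system :: "X set list \<Rightarrow> (nat \<Rightarrow> nat \<Rightarrow> X) \<Rightarrow> bool" where
  "defining_system as a \<longleftrightarrow>
     (\<forall>i\<in>{1..length as}. a (i - 1) i \<in> cycles \<and> hclass (a (i - 1) i) = as ! (i - 1)) \<and>
     (\<forall>i j. i < j \<and> j \<le> length as \<and> (i, j) \<noteq> (0, length as) \<longrightarrow>
        d (a i j) = (\<Sum>l\<in>{i<..<j}. a i l * a l j))"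

definition massey_product :: "X set list \<Rightarrow> X set set" where
  "massey_product as =
     {hclass (\<Sum>l\<in>{0<..<length as}. a 0 l * a l (length as)) | a. defining_system as a}"

end

theory Submission
  imports Defs
begin

text \<open>
  Translate indices so that \<open>k = 0\<close>, write \<open>S' = S - {0}\<close>, and write \<open>D A B\<close> for the minor of \<open>R\<close>
  with rows \<open>A\<close> and columns \<open>B\<close>. Over a field with two elements determinants are permanents, so no
  sign and no order of rows or columns matters. The coefficient of \<open>R 0 t\<close> in the expansion of
  \<open>D S T\<close> along its first row is the minor \<open>c t = D S' (T - {t})\<close>; put \<open>c l = 0\<close> if \<open>l \<notin> T\<close>. The
  defining system is \<open>a i j = R i j\<close> for \<open>j < 2 * n\<close> and \<open>a l (2 * n) = c l\<close>. With this choice every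
  sum \<open>\<Sum>m. a l m * a m (2 * n)\<close> over \<open>l < m < 2 * n\<close> is the first-row expansion of the determinant
  \<open>D (l, S') T\<close> with rows \<open>l\<close> and \<open>S'\<close>, where row \<open>l\<close> occurs twice if \<open>l \<in> S'\<close>. For \<open>l = 0\<close> this is
  \<open>D S T\<close>, on the level of cycles and not only of classes. What remains is \<open>d (c l) = D (l, S') T\<close>
  for \<open>0 < l < 2 * n\<close>. If \<open>l \<in> S'\<close>, both sides vanish, the right one because of the repeated row.

  If \<open>l \<in> T\<close>, this is lemma \<open>d_permanent_omit_column\<close>. The differential of an entry,
  \<open>d (R s t) = \<Sum>m. R s m * R m t\<close>, splits the differential of a minor by the intermediate index
  \<open>m\<close>: the part belonging to \<open>m\<close> is the sum, over the rows \<open>s\<close>, of \<open>R s m\<close> times the minor with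
  row \<open>s\<close> replaced by row \<open>m\<close> (\<open>replace_sum\<close>). If \<open>m\<close> is already a row, every summand has a repeated
  row or the factor \<open>R m m = 0\<close>. If \<open>m\<close> is not a column, the sum is the expansion along column \<open>m\<close>
  of the minor enlarged by row and column \<open>m\<close>; and if \<open>m\<close> is already a column, it is the
  corresponding expansion with a repeated column, hence zero. Since \<open>S' \<union> T\<close> consists of all indices
  from 1 to \<open>2 * n - 1\<close>, and since \<open>m\<close> must lie strictly between a row index and a column index, only
  \<open>m = l\<close> survives in \<open>d (c l)\<close>, and restoring column \<open>l\<close> gives the claim.
\<close>

section \<open>Permanents\<close>

text \<open>
  Rows form a list so that they can be repeated and replaced in place. Columns form a set so that
  one of them can be omitted or restored without regard to order. This is the usual permanent only
  if there are as many columns as rows.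
\<close>

fun permanent :: "('r \<Rightarrow> 'c \<Rightarrow> 'a::comm_semiring_1) \<Rightarrow> 'r list \<Rightarrow> 'c set \<Rightarrow> 'a" where
  "permanent M [] U = 1"
| "permanent M (r # rs) U = (\<Sum>u\<in>U. M r u * permanent M rs (U - {u}))"

text \<open>
  Both sides have the same expansion along the first row, because the signs of the cofactors are 1.
\<close>

lemma det_eq_permanent:
  fixes M :: "'r \<Rightarrow> 'c \<Rightarrow> 'a::comm_ring_1"
  assumes char2: "\<And>x::'a. x + x = 0"
    and "distinct cs" "length cs = length rs"
  shows "det (mat (length rs) (length rs) (\<lambda>(i, j). M (rs ! i) (cs ! j))) = permanent M rs (set cs)"
  using assms(2,3)
proof (induction rs arbitrary: cs)
  case Nil
  then show ?case by simp
next
  case (Cons r rs)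
  let ?n = "length rs"
  let ?A = "mat (Suc ?n) (Suc ?n) (\<lambda>(i, j). M ((r # rs) ! i) (cs ! j))"
  have sign: "(-1) ^ e = (1::'a)" for e :: nat
    using char2[of 1] by (induction e) (simp_all add: add_eq_0_iff)
  have minor: "det (mat_delete ?A 0 j) = permanent M rs (set cs - {cs ! j})" if j: "j < Suc ?n" for j
  proof -
    let ?cs = "take j cs @ drop (Suc j) cs"
    have cs: "cs = take j cs @ cs ! j # drop (Suc j) cs"
      using j Cons.prems by (simp add: id_take_nth_drop)
    have dist: "distinct (take j cs @ cs ! j # drop (Suc j) cs)"
      using Cons.prems(1) cs by metis
    have set: "set ?cs = set cs - {cs ! j}"
      using dist by (subst (3) cs) auto
    have "mat_delete ?A 0 j = mat ?n ?n (\<lambda>(i, j). M (rs ! i) (?cs ! j))"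
      using j Cons.prems(2)
      by (intro eq_matI) (auto simp: mat_delete_def nth_append min_def)
    then show ?thesis
      using Cons.IH[of ?cs] dist j Cons.prems(2) unfolding set by simp
  qed
  have "det ?A = (\<Sum>j<Suc ?n. ?A $$ (0, j) * cofactor ?A 0 j)"
    by (rule laplace_expansion_row) auto
  also have "\<dots> = (\<Sum>j<Suc ?n. M r (cs ! j) * permanent M rs (set cs - {cs ! j}))"
    by (rule sum.cong) (simp_all add: cofactor_def sign minor)
  also have "\<dots> = (\<Sum>u\<in>set cs. M r u * permanent M rs (set cs - {u}))"
    by (rule sum.reindex_bij_betw, rule bij_betw_nth) (use Cons.prems in auto)
  finally show ?case by simp
qed

lemma permanent_eq_0_if_repeated_row:
  fixes M :: "'r \<Rightarrow> 'c \<Rightarrow> 'a::comm_ring_1"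
  assumes char2: "\<And>x::'a. x + x = 0"
    and "finite U" "card U = length rs" "\<not> distinct rs"
  shows "permanent M rs U = 0"
proof -
  obtain cs where cs: "set cs = U" "distinct cs"
    using finite_distinct_list[OF \<open>finite U\<close>] by blast
  then have len: "length cs = length rs"
    using assms(3) distinct_card by fastforce
  obtain i j where ij: "i < length rs" "j < length rs" "i \<noteq> j" "rs ! i = rs ! j"
    using assms(4) by (auto simp: distinct_conv_nth)
  let ?A = "mat (length rs) (length rs) (\<lambda>(i, j). M (rs ! i) (cs ! j))"
  have "det ?A = 0"
  proof (rule det_identical_rows)
    show "row ?A i = row ?A j" using ij by (intro eq_vecI) auto
  qed (use ij in auto)
  then show ?thesis
    using det_eq_permanent[OF char2 cs(2) len] cs(1) by metis
qed

section \<open>Replacing one row in all possible ways\<close>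

text \<open>
  With \<open>M = R\<close>, this is the contribution of the intermediate index \<open>m\<close> to the differential of a
  minor. It looks like the expansion of a larger permanent along column \<open>m\<close>: moving the row \<open>m\<close>
  from place \<open>i\<close> to the front turns \<open>rs[i := m]\<close> into \<open>m # rs\<close> with its row \<open>rs ! i\<close> deleted.
\<close>

definition replace_sum :: "('i \<Rightarrow> 'i \<Rightarrow> 'a::comm_semiring_1) \<Rightarrow> 'i \<Rightarrow> 'i list \<Rightarrow> 'i set \<Rightarrow> 'a" where
  "replace_sum M m rs U = (\<Sum>i<length rs. M (rs ! i) m * permanent M (rs[i := m]) U)"

lemma replace_sum_Nil [simp]: "replace_sum M m [] U = 0"
  by (simp add: replace_sum_def)

lemma replace_sum_Cons:
  "replace_sum M m (r # rs) U =
     M r m * permanent M (m # rs) U + (\<Sum>u\<in>U. M r u * replace_sum M m rs (U - {u}))"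
proof -
  have "(\<Sum>i<length rs. M (rs ! i) m * (\<Sum>u\<in>U. M r u * permanent M (rs[i := m]) (U - {u}))) =
      (\<Sum>u\<in>U. M r u * replace_sum M m rs (U - {u}))"
    unfolding replace_sum_def sum_distrib_left
    by (subst sum.swap) (simp add: mult_ac)
  then show ?thesis
    unfolding replace_sum_def[of M m "r # rs"] by (simp add: sum.lessThan_Suc_shift del: sum.lessThan_Suc)
qed

lemma sum_swap_off_diagonal:
  assumes "finite U"
  shows "(\<Sum>u\<in>U. \<Sum>t\<in>U - {u}. f u t) = (\<Sum>t\<in>U. \<Sum>u\<in>U - {t}. f u t)"
proof -
  have *: "U - {u} = {t \<in> U. t \<noteq> u}" for u by auto
  show ?thesis
    unfolding * using sum.swap_restrict[OF assms assms, of f "\<lambda>u t. t \<noteq> u"] by (simp add: eq_commute)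
qed

text \<open>
  Row \<open>m\<close> has the entry 0 in column \<open>m\<close>, so its expansion leaves column \<open>m\<close> in place.
\<close>

lemma permanent_insert_own_column:
  fixes M :: "'i \<Rightarrow> 'i \<Rightarrow> 'a::comm_semiring_1"
  assumes "M m m = 0" "finite U" "m \<notin> U"
  shows "permanent M (m # rs) (insert m U) = (\<Sum>t\<in>U. M m t * permanent M rs (insert m (U - {t})))"
proof -
  have "insert m U - {t} = insert m (U - {t})" if "t \<in> U" for t using that assms(3) by auto
  then show ?thesis using assms by simp
qed

text \<open>
  This is the expansion along column \<open>m\<close>; row \<open>m\<close> contributes nothing to it as \<open>M m m = 0\<close>. Permanents
  are defined by row expansion, so the induction expands both sides along row \<open>r\<close> and row \<open>m\<close>
  and exchanges the columns \<open>u\<close> and \<open>t\<close> chosen in these two rows.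
\<close>

lemma replace_sum_new_column:
  fixes M :: "'i \<Rightarrow> 'i \<Rightarrow> 'a::comm_semiring_1"
  assumes "M m m = 0" "finite U" "m \<notin> U" "card U = length rs"
  shows "replace_sum M m rs U = permanent M (m # rs) (insert m U)"
  using assms(2-)
proof (induction rs arbitrary: U)
  case Nil
  then show ?case using assms(1) by simp
next
  case (Cons r rs)
  let ?P = "permanent M"
  have "replace_sum M m (r # rs) U =
      M r m * ?P (m # rs) U + (\<Sum>u\<in>U. M r u * ?P (m # rs) (insert m (U - {u})))"
    using Cons by (simp add: replace_sum_Cons)
  also have "(\<Sum>u\<in>U. M r u * ?P (m # rs) (insert m (U - {u}))) =
      (\<Sum>u\<in>U. \<Sum>t\<in>U - {u}. M r u * (M m t * ?P rs (insert m (U - {u} - {t}))))"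
    using Cons.prems assms(1)
    by (simp add: permanent_insert_own_column sum_distrib_left del: permanent.simps)
  also have "\<dots> = (\<Sum>t\<in>U. \<Sum>u\<in>U - {t}. M r u * (M m t * ?P rs (insert m (U - {u} - {t}))))"
    by (rule sum_swap_off_diagonal) (use Cons in auto)
  also have "M r m * ?P (m # rs) U + \<dots> =
      (\<Sum>t\<in>U. M m t * (M r m * ?P rs (U - {t}) +
         (\<Sum>u\<in>U - {t}. M r u * ?P rs (insert m (U - {t} - {u})))))"
  proof -
    have "U - {u} - {t} = U - {t} - {u}" for u t by auto
    then show ?thesis
      by (simp add: sum_distrib_left sum.distrib distrib_left mult.left_commute)
  qed
  also have "\<dots> = (\<Sum>t\<in>U. M m t * ?P (r # rs) (insert m (U - {t})))"
  proof (rule sum.cong[OF refl])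
    fix t assume "t \<in> U"
    have "insert m (U - {t}) - {u} = insert m (U - {t} - {u})" if "u \<in> U" for u
      using that Cons.prems by auto
    moreover have "insert m (U - {t}) - {m} = U - {t}" using Cons.prems by auto
    ultimately show "M m t * (M r m * ?P rs (U - {t}) +
         (\<Sum>u\<in>U - {t}. M r u * ?P rs (insert m (U - {t} - {u})))) =
        M m t * ?P (r # rs) (insert m (U - {t}))"
      using Cons.prems by simp
  qed
  finally show ?case
    using permanent_insert_own_column[of M m U "r # rs"] assms(1) Cons.prems by (simp del: permanent.simps)
qed

text \<open>
  Here the expansion along column \<open>m\<close> is that of a permanent in which column \<open>m\<close> occurs twice.
  In the induction, the term where row \<open>r\<close> uses column \<open>m\<close> leaves a set without \<open>m\<close>, so that the
  preceding lemma applies to it; it then equals the term in which row \<open>r\<close> is replaced, and the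
  two cancel in characteristic 2.
\<close>

lemma replace_sum_old_column:
  fixes M :: "'i \<Rightarrow> 'i \<Rightarrow> 'a::comm_ring_1"
  assumes char2: "\<And>x::'a. x + x = 0"
    and "M m m = 0" "finite U" "m \<in> U" "card U = length rs"
  shows "replace_sum M m rs U = 0"
  using assms(3-)
proof (induction rs arbitrary: U)
  case Nil
  then show ?case by simp
next
  case (Cons r rs)
  have "replace_sum M m rs (U - {u}) = (if u = m then permanent M (m # rs) U else 0)" if "u \<in> U" for u
    using that Cons replace_sum_new_column[of M m "U - {u}" rs] assms(2)
    by (auto simp: insert_absorb simp del: permanent.simps)
  then have "(\<Sum>u\<in>U. M r u * replace_sum M m rs (U - {u})) =
      (\<Sum>u\<in>U. if u = m then M r m * permanent M (m # rs) U else 0)"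
    by (intro sum.cong) auto
  also have "\<dots> = M r m * permanent M (m # rs) U"
    using Cons.prems by simp
  finally show ?case
    by (simp only: replace_sum_Cons char2)
qed

lemma replace_sum_old_row:
  fixes M :: "'i \<Rightarrow> 'i \<Rightarrow> 'a::comm_ring_1"
  assumes char2: "\<And>x::'a. x + x = 0"
    and "M m m = 0" "finite U" "m \<in> set rs" "card U = length rs"
  shows "replace_sum M m rs U = 0"
proof -
  have "M (rs ! i) m * permanent M (rs[i := m]) U = 0" if i: "i < length rs" for i
  proof (cases "rs ! i = m")
    case False
    obtain j where j: "j < length rs" "rs ! j = m" using assms(4) by (auto simp: in_set_conv_nth)
    with False have "i \<noteq> j" by auto
    then have "rs[i := m] ! i = rs[i := m] ! j"
      using i j by simp
    then have "\<not> distinct (rs[i := m])"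
      using i j \<open>i \<noteq> j\<close> unfolding distinct_conv_nth by (metis length_list_update)
    then have "permanent M (rs[i := m]) U = 0"
      using assms by (intro permanent_eq_0_if_repeated_row) auto
    then show ?thesis by simp
  qed (use assms in simp)
  then show ?thesis by (simp add: replace_sum_def)
qed

section \<open>The differential of a minor\<close>

lemma R_eq_0: "\<not> i < j \<Longrightarrow> R i j = 0"
  by (simp add: R_def)

text \<open>
  The summation range is independent of \<open>i\<close> and \<open>j\<close>, so that it can be exchanged with sums over the
  entries of a matrix.
\<close>

lemma d_R_bounded:
  assumes "j \<le> b"
  shows "d (R i j) = (\<Sum>m<b. R i m * R m j)"
  unfolding d_R by (rule sum.mono_neutral_left) (use assms in \<open>auto simp: R_def\<close>)

lemma d_permanent:
  assumes "finite U" "\<And>u. u \<in> U \<Longrightarrow> u \<le> b"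
  shows "d (permanent R rs U) = (\<Sum>m<b. replace_sum R m rs U)"
  using assms
proof (induction rs arbitrary: U)
  case Nil
  then show ?case by simp
next
  case (Cons r rs)
  have "d (permanent R (r # rs) U) =
      (\<Sum>u\<in>U. (\<Sum>m<b. R r m * R m u) * permanent R rs (U - {u}) +
                R r u * (\<Sum>m<b. replace_sum R m rs (U - {u})))"
    unfolding permanent.simps d_sum d_mult
  proof (rule sum.cong[OF refl])
    fix u assume "u \<in> U"
    then have "d (permanent R rs (U - {u})) = (\<Sum>m<b. replace_sum R m rs (U - {u}))"
      by (intro Cons.IH) (use Cons.prems in auto)
    then show "d (R r u) * permanent R rs (U - {u}) + R r u * d (permanent R rs (U - {u})) =
        (\<Sum>m<b. R r m * R m u) * permanent R rs (U - {u}) +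
        R r u * (\<Sum>m<b. replace_sum R m rs (U - {u}))"
      using \<open>u \<in> U\<close> Cons.prems by (simp add: d_R_bounded[of u b])
  qed
  also have "\<dots> = (\<Sum>u\<in>U. \<Sum>m<b. R r m * (R m u * permanent R rs (U - {u})) +
                R r u * replace_sum R m rs (U - {u}))"
    by (simp add: sum_distrib_left sum_distrib_right sum.distrib mult.assoc)
  also have "\<dots> = (\<Sum>m<b. replace_sum R m (r # rs) U)"
    by (subst sum.swap) (simp add: replace_sum_Cons sum_distrib_left sum.distrib)
  finally show ?case .
qed

text \<open>
  Every intermediate index below \<open>b\<close> other than \<open>l\<close> is at most \<open>k\<close>, hence not larger than any row
  index, or is itself a row or a remaining column. In each case its contribution is zero.
\<close>

lemma d_permanent_omit_column:
  assumes T: "finite T" "l \<in> T" "card T = Suc (length rs)"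
    and interval: "set rs \<union> T = {k<..<b}" and "l \<notin> set rs"
  shows "d (permanent R rs (T - {l})) = permanent R (l # rs) T"
proof -
  let ?U = "T - {l}"
  have card: "card ?U = length rs" using T by simp
  have vanish: "replace_sum R m rs ?U = 0" if m: "m \<noteq> l" "m < b" for m
  proof (cases "m \<le> k")
    case True
    have "R (rs ! i) m = 0" if "i < length rs" for i
    proof -
      have "rs ! i \<in> {k<..<b}" using nth_mem[OF that] interval by blast
      then show ?thesis using True by (intro R_eq_0) auto
    qed
    then show ?thesis by (simp add: replace_sum_def)
  next
    case False
    then have "m \<in> set rs \<union> T" unfolding interval using m by simp
    with m consider "m \<in> set rs" | "m \<in> ?U" by blast
    then show ?thesis
    proof cases
      case 1
      then show ?thesis
        by (intro replace_sum_old_row X_char_2) (use T card in \<open>simp_all add: R_eq_0\<close>)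
    next
      case 2
      then show ?thesis
        by (intro replace_sum_old_column X_char_2) (use T card in \<open>simp_all add: R_eq_0\<close>)
    qed
  qed
  have below: "u < b" if "u \<in> T" for u using that interval by auto
  have "d (permanent R rs ?U) = (\<Sum>m<b. replace_sum R m rs ?U)"
    by (rule d_permanent) (use T below in \<open>auto intro: less_imp_le\<close>)
  also have "\<dots> = (\<Sum>m\<in>{l}. replace_sum R m rs ?U)"
    by (rule sum.mono_neutral_right) (use below T in \<open>auto intro: vanish\<close>)
  also have "\<dots> = permanent R (l # rs) (insert l ?U)"
    using replace_sum_new_column[of R l ?U rs] T card by (simp add: R_eq_0 del: permanent.simps)
  finally show ?thesis using T by (simp add: insert_absorb del: permanent.simps)
qed

lemma R_det_eq_permanent:
  assumes "finite S" "finite T" "card S = card T"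
  shows "R_det S T = permanent R (sorted_list_of_set S) T"
proof -
  have "R_det S T = det (mat (length (sorted_list_of_set S)) (length (sorted_list_of_set S))
      (\<lambda>(i, j). R (sorted_list_of_set S ! i) (sorted_list_of_set T ! j)))"
    unfolding R_det_def elt_def using assms by simp
  also have "\<dots> = permanent R (sorted_list_of_set S) (set (sorted_list_of_set T))"
    by (rule det_eq_permanent) (use assms in \<open>simp_all add: X_char_2\<close>)
  finally show ?thesis using assms by simp
qed

section \<open>The endpoints of a pair\<close>

lemma elt_in:
  assumes "finite A" "1 \<le> j" "j \<le> card A"
  shows "elt A j \<in> A"
  using nth_mem[of "j - 1" "sorted_list_of_set A"] assms by (simp add: elt_def)

lemma elt_first_last:
  assumes "finite A" "x \<in> A"
  shows "elt A 1 \<le> x" "x \<le> elt A (card A)"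
proof -
  obtain i where i: "i < card A" "x = sorted_list_of_set A ! i"
    using assms by (metis in_set_conv_nth length_sorted_list_of_set set_sorted_list_of_set)
  then show "elt A 1 \<le> x" "x \<le> elt A (card A)"
    unfolding elt_def by (auto intro!: sorted_nth_mono simp: sorted_sorted_list_of_set)
qed

text \<open>
  The smallest index of the union lies in \<open>S\<close> because \<open>min S < min T\<close>, and the largest lies in \<open>T\<close>
  because \<open>max S < max T\<close>.
\<close>

lemma H_pair_interval:
  assumes "H_pair S T" and U: "S \<union> T = {k..<k + 2 * n}"
  shows "n \<ge> 1" "finite S" "finite T" "card S = n" "card T = n" "S \<inter> T = {}"
    "k \<in> S" "k + 2 * n - 1 \<in> T"
proof -
  obtain n' k' where H: "n' \<ge> 1" "finite S" "finite T" "card S = n'" "card T = n'"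
     "S \<union> T = {k'..<k' + 2 * n'}" "\<And>j. j \<in> {1..n'} \<Longrightarrow> elt S j < elt T j"
    using assms(1) unfolding H_pair_def by blast
  have "card {k..<k + 2 * n} = card {k'..<k' + 2 * n'}" using H U by simp
  then have n: "n' = n" by simp
  show *: "n \<ge> 1" "finite S" "finite T" "card S = n" "card T = n" using H n by auto
  have "card (S \<union> T) = card S + card T" unfolding U using * by simp
  then show "S \<inter> T = {}" using * card_Un_Int[of S T] by simp
  have "elt S 1 \<in> S \<union> T" "elt T n \<in> S \<union> T" using elt_in[of S 1] elt_in[of T n] * by auto
  then have bounds: "k \<le> elt S 1" "elt T n \<le> k + 2 * n - 1" unfolding U by auto
  have "k \<in> S \<union> T" "k + 2 * n - 1 \<in> S \<union> T" unfolding U using * by auto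
  moreover have "k \<notin> T" using elt_first_last(1)[of T k] bounds H(7)[of 1] * n by auto
  moreover have "k + 2 * n - 1 \<notin> S"
    using elt_first_last(2)[of S "k + 2 * n - 1"] bounds H(7)[of n] * n by auto
  ultimately show "k \<in> S" "k + 2 * n - 1 \<in> T" by auto
qed

section \<open>The Massey product\<close>

theorem theorem2p36:
  fixes S T :: "nat set" and k n :: nat
  assumes "H_pair S T"
    and "S \<union> T = {k..<k + 2 * n}"
  shows "h_det S T \<in>
    massey_product (map h [k..<k + 2 * n - 1] @ [h_det (S - {k}) (T - {k + 2 * n - 1})])"
proof -
  note H = H_pair_interval[OF assms]
  define N where "N = 2 * n"
  define rs where "rs = sorted_list_of_set (S - {k})"
  define as where "as = map h [k..<k + N - 1] @ [h_det (S - {k}) (T - {k + N - 1})]"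
  define c where "c l = (if k + l \<in> T then permanent R rs (T - {k + l}) else 0)" for l
  define a where "a i j = (if j = N then c i else R (k + i) (k + j))" for i j
  have N: "N \<ge> 2" using H by (simp add: N_def)
  have len: "length as = N" using N by (simp add: as_def)
  have rs: "set rs = S - {k}" "length rs = n - 1" using H by (simp_all add: rs_def)
  have interval: "set rs \<union> T = {k<..<k + N}"
  proof -
    have "set rs \<union> T = (S \<union> T) - {k}" using rs H by blast
    also have "\<dots> = {k<..<k + N}" unfolding assms(2) N_def by auto
    finally show ?thesis .
  qed
  have T: "T \<subseteq> {k<..<k + N}" using interval by blast

  \<comment> \<open>The case \<open>i = 0\<close> evaluates the Massey product; the others are needed for the defining system.\<close>
  have expand: "(\<Sum>l\<in>{i<..<N}. a i l * a l N) = permanent R ((k + i) # rs) T" if "i < N" for i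
  proof -
    have "(\<Sum>t\<in>T. R (k + i) t * permanent R rs (T - {t})) =
        (\<Sum>t\<in>{k + i<..<k + N}. R (k + i) t * c (t - k))"
    proof (rule sum.mono_neutral_cong)
      show "R (k + i) t * permanent R rs (T - {t}) = 0" if "t \<in> T - {k + i<..<k + N}" for t
        using that T by (auto simp: R_def)
    qed (use H(3) in \<open>auto simp: c_def\<close>)
    then have "permanent R ((k + i) # rs) T = (\<Sum>t\<in>{k + i<..<k + N}. R (k + i) t * c (t - k))"
      by simp
    also have "\<dots> = (\<Sum>l\<in>{i<..<N}. R (k + i) (k + l) * c l)"
      by (rule sum.reindex_bij_witness[of _ "\<lambda>l. k + l" "\<lambda>t. t - k"]) auto
    also have "\<dots> = (\<Sum>l\<in>{i<..<N}. a i l * a l N)"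
      by (rule sum.cong) (simp_all add: a_def)
    finally show ?thesis by simp
  qed
  have d_c: "d (c i) = permanent R ((k + i) # rs) T" if "0 < i" "i < N" for i
  proof (cases "k + i \<in> T")
    case True
    then have "k + i \<notin> set rs" using H by (auto simp: rs)
    then show ?thesis
      using d_permanent_omit_column[OF H(3) True _ interval] True H rs by (simp add: c_def del: permanent.simps)
  next
    case False
    then have "k + i \<in> set rs" using interval that by auto
    then have "permanent R ((k + i) # rs) T = 0"
      using H rs by (intro permanent_eq_0_if_repeated_row X_char_2) auto
    then show ?thesis using False by (simp add: c_def)
  qed
  have d_a: "d (a i j) = (\<Sum>l\<in>{i<..<j}. a i l * a l j)"
    if ij: "i < j" "j \<le> N" "(i, j) \<noteq> (0, N)" for i j
  proof (cases "j = N")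
    case True
    then show ?thesis using ij expand[of i] d_c[of i] by (simp add: a_def)
  next
    case False
    have "d (R (k + i) (k + j)) = (\<Sum>t\<in>{k + i<..<k + j}. R (k + i) t * R t (k + j))"
      by (rule d_R)
    also have "\<dots> = (\<Sum>l\<in>{i<..<j}. R (k + i) (k + l) * R (k + l) (k + j))"
      by (rule sum.reindex_bij_witness[of _ "\<lambda>l. k + l" "\<lambda>t. t - k"]) auto
    also have "\<dots> = (\<Sum>l\<in>{i<..<j}. a i l * a l j)"
      by (rule sum.cong) (use False ij in \<open>auto simp: a_def\<close>)
    finally show ?thesis using False by (simp add: a_def)
  qed
  have "defining_system as a"
    unfolding defining_system_def len
  proof (intro conjI ballI allI impI)
    fix i assume i: "i \<in> {1..N}"
    then have "{i - 1<..<i} = {}" by auto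
    then show "a (i - 1) i \<in> cycles"
      using d_a[of "i - 1" i] i N by (auto simp: cycles_def)
    show "hclass (a (i - 1) i) = as ! (i - 1)"
    proof (cases "i = N")
      case True
      have top: "k + (N - 1) = k + N - 1" "k + N - 1 \<in> T" using N H by (simp_all add: N_def)
      have "R_det (S - {k}) (T - {k + N - 1}) = permanent R rs (T - {k + N - 1})"
        unfolding rs_def by (rule R_det_eq_permanent) (use H top in auto)
      then show ?thesis
        using True N top by (simp add: a_def c_def as_def nth_append h_det_def)
    next
      case False
      then show ?thesis
        using i by (auto simp: a_def as_def nth_append h_def)
    qed
  qed (use d_a in auto)
  moreover have "R_det S T = (\<Sum>l\<in>{0<..<length as}. a 0 l * a l (length as))"
  proof -
    have "Min S = k"
      by (rule Min_eqI) (use H assms(2) in auto)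
    then have "sorted_list_of_set S = k # rs"
      unfolding rs_def using sorted_list_of_set_nonempty[of S] H by auto
    then show ?thesis
      unfolding len using expand[of 0] N R_det_eq_permanent[of S T] H by simp
  qed
  ultimately show ?thesis
    unfolding massey_product_def h_det_def as_def N_def by auto
qed

end
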